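(* Let $B$ be the ordinal sum of copulas $\{B_k\mid k=1,\ldots,n\}$ with respect to a finite family $\{(a_k,b_k)\mid k=1,\ldots,n\}$ of disjoint open subintervals of $[0,1]$. Then Kendall's tau of $B$ is $$\tau(B)=1-\sum_{k=1}^n(b_k-a_k)^2(1-\tau(B_k)).$$
   Context: Let $\mathbb{I}=[0,1]$. A (bivariate) copula is a function $C:\mathbb{I}^2\to\mathbb{I}$ with $C(0,v)=C(u,0)=0$, $C(u,1)=u$, $C(1,v)=v$ for all $u,v\in\mathbb{I}$, and $C(u_2,v_2)-C(u_2,v_1)-C(u_1,v_2)+C(u_1,v_1)\ge 0$ whenever $u_1\le u_2$, $v_1\le v_2$ in $\mathbb{I}$. Each copula induces a Borel probability measure $\mu_C$ on $\mathbb{I}^2$ with $\mu_C([0,u]\times[0,v])=C(u,v)$; integration against it is written $dC(u,v)$. Given disjoint open subintervals $(a_k,b_k)$ of $\mathbb{I}$ and copulas $B_k$, $k=1,\ldots,n$, the ordinal sum $B$ of $\{B_k\}$ with respect to $\{(a_k,b_k)\}$ is the copula defined by $B(u,v)=a_k+(b_k-a_k)B_k\big(\frac{u-a_k}{b_k-a_k},\frac{v-a_k}{b_k-a_k}\big)$ if $(u,v)\in[a_k,b_k]^2$ for some $k$, and $B(u,v)=\min\{u,v\}$ otherwise. Kendall's tau of a copula $C$ is $\tau(C)=4\int_{\mathbb{I}^2}C(u,v)\,dC(u,v)-1$. *)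

theory Defs
  imports "HOL-Probability.Probability"
begin

abbreviation unit_square :: "(real \<times> real) set"
  where "unit_square \<equiv> {0..1} \<times> {0..1}"

text \<open>Copulas are represented by total functions on the plane of which only the values on the
  unit square matter; nothing is assumed about, and nothing below depends on, the other values.\<close>

definition copula :: "(real \<Rightarrow> real \<Rightarrow> real) \<Rightarrow> bool" where
  "copula C \<longleftrightarrow>
     (\<forall>u\<in>{0..1}. \<forall>v\<in>{0..1}. C u v \<in> {0..1}) \<and>
     (\<forall>v\<in>{0..1}. C 0 v = 0) \<and> (\<forall>u\<in>{0..1}. C u 0 = 0) \<and>
     (\<forall>u\<in>{0..1}. C u 1 = u) \<and> (\<forall>v\<in>{0..1}. C 1 v = v) \<and>
     (\<forall>u1\<in>{0..1}. \<forall>u2\<in>{0..1}. \<forall>v1\<in>{0..1}. \<forall>v2\<in>{0..1}. u1 \<le> u2 \<longrightarrow> v1 \<le> v2 \<longrightarrow>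
        C u2 v2 - C u2 v1 - C u1 v2 + C u1 v1 \<ge> 0)"

text \<open>The description is unique because the rectangles anchored at the origin form an
  intersection-stable generator of the Borel sets of the unit square.\<close>

definition copula_measure :: "(real \<Rightarrow> real \<Rightarrow> real) \<Rightarrow> (real \<times> real) measure" where
  "copula_measure C = (THE M. prob_space M \<and> sets M = sets (restrict_space borel unit_square) \<and>
     (\<forall>u\<in>{0..1}. \<forall>v\<in>{0..1}. measure M ({0..u} \<times> {0..v}) = C u v))"

definition kendall_tau :: "(real \<Rightarrow> real \<Rightarrow> real) \<Rightarrow> real" where
  "kendall_tau C = 4 * (\<integral>(u, v). C u v \<partial>copula_measure C) - 1"

text \<open>Two of the closed squares can only meet in a common corner on the diagonal, where the
  corresponding formulas agree, so the value does not depend on the choice of the index;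
  see \<open>ordinal_sum_eq\<close>.\<close>

definition ordinal_sum ::
    "'i set \<Rightarrow> ('i \<Rightarrow> real) \<Rightarrow> ('i \<Rightarrow> real) \<Rightarrow> ('i \<Rightarrow> real \<Rightarrow> real \<Rightarrow> real) \<Rightarrow> real \<Rightarrow> real \<Rightarrow> real" where
  "ordinal_sum K a b C u v =
     (if \<exists>k\<in>K. (u, v) \<in> {a k..b k} \<times> {a k..b k}
      then let k = (SOME k. k \<in> K \<and> (u, v) \<in> {a k..b k} \<times> {a k..b k})
           in a k + (b k - a k) * C k ((u - a k) / (b k - a k)) ((v - a k) / (b k - a k))
      else min u v)"

lemma ordinal_sum_eq:
  assumes cop: "\<And>i. i \<in> K \<Longrightarrow> copula (C i)"
    and ab: "\<And>i. i \<in> K \<Longrightarrow> a i < b i"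
    and disj: "disjoint_family_on (\<lambda>i. {a i<..<b i}) K"
    and k: "k \<in> K" "(u, v) \<in> {a k..b k} \<times> {a k..b k}"
  shows "ordinal_sum K a b C u v =
    a k + (b k - a k) * C k ((u - a k) / (b k - a k)) ((v - a k) / (b k - a k))"
proof -
  let ?P = "\<lambda>l. l \<in> K \<and> (u, v) \<in> {a l..b l} \<times> {a l..b l}"
  let ?f = "\<lambda>l. a l + (b l - a l) * C l ((u - a l) / (b l - a l)) ((v - a l) / (b l - a l))"
  define l where "l = (SOME l. ?P l)"
  have l: "?P l" unfolding l_def by (rule someI[of ?P k]) (use k in auto)
  have 00: "C i 0 0 = 0" and 11: "C i 1 1 = 1" if "i \<in> K" for i
    using cop[OF that] by (auto simp: copula_def)
  have low: "?f i = a i" if "i \<in> K" "u = a i" "v = a i" for i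
    using that 00 by simp
  have high: "?f i = b i" if "i \<in> K" "u = b i" "v = b i" for i
    using that 11 ab[OF that(1)] by simp
  have eq: "?f l = ?f k"
  proof (cases "l = k")
    case False
    then have e: "{a l<..<b l} \<inter> {a k<..<b k} = {}"
      using disj l k by (auto simp: disjoint_family_on_def)
    have "b l \<le> a k \<or> b k \<le> a l"
    proof (rule ccontr)
      assume "\<not> ?thesis"
      then have "max (a l) (a k) < min (b l) (b k)" using ab l k by auto
      then obtain x where "max (a l) (a k) < x" "x < min (b l) (b k)" using dense by blast
      then have "x \<in> {a l<..<b l} \<inter> {a k<..<b k}" by auto
      with e show False by blast
    qed
    then show ?thesis
    proof
      assume "b l \<le> a k"
      then have *: "u = b l" "v = b l" "u = a k" "v = a k" using l k by auto
      have "?f l = b l" by (rule high) (use l * in auto)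
      moreover have "?f k = a k" by (rule low) (use k * in auto)
      ultimately show ?thesis using * by simp
    next
      assume "b k \<le> a l"
      then have *: "u = b k" "v = b k" "u = a l" "v = a l" using l k by auto
      have "?f k = b k" by (rule high) (use k * in auto)
      moreover have "?f l = a l" by (rule low) (use l * in auto)
      ultimately show ?thesis using * by simp
    qed
  qed simp
  have ex: "\<exists>k\<in>K. (u, v) \<in> {a k..b k} \<times> {a k..b k}" using k by blast
  have "ordinal_sum K a b C u v = ?f l"
    unfolding ordinal_sum_def l_def by (simp only: ex if_True Let_def)
  with eq show ?thesis by simp
qed

end

theory Submission
  imports Defs
begin

text \<open>To sample from the ordinal sum, draw \<open>t\<close> uniformly from \<open>[0,1]\<close>. If \<open>t\<close> falls into a block
  \<open>(a\<^sub>k, b\<^sub>k)\<close>, forget it and place a point drawn from the copula measure of \<open>C\<^sub>k\<close> affinely into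
  \<open>[a\<^sub>k, b\<^sub>k]\<^sup>2\<close>; otherwise take the diagonal point \<open>(t, t)\<close>. Inside block \<open>k\<close> the ordinal sum is
  \<open>a\<^sub>k + (b\<^sub>k - a\<^sub>k) C\<^sub>k\<close> and at the diagonal points it is \<open>t\<close>, so its mean is \<open>1/2\<close> with the contribution
  \<open>(b\<^sub>k\<^sup>2 - a\<^sub>k\<^sup>2)/2\<close> of each block replaced by \<open>(b\<^sub>k - a\<^sub>k) (a\<^sub>k + (b\<^sub>k - a\<^sub>k) (\<tau>\<^sub>k + 1)/4)\<close>.

  That the copula measures exist follows from Caratheodory's theorem on the semiring of half-open
  rectangles. Finite additivity comes for free, because the rectangle volume is the limit of the
  contents of discrete measures on finer and finer grids; countable additivity follows by compactness
  from the Lipschitz continuity of copulas.\<close>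

section \<open>Copulas extended to the plane\<close>

definition clip :: "real \<Rightarrow> real" where
  "clip x = max 0 (min 1 x)"

text \<open>As \<open>C\<close> is arbitrary off the unit square, it is read through the projection
  of both coordinates onto \<open>[0,1]\<close>. The result is the distribution function, on the
  whole plane, of the measure to be constructed.\<close>

definition copula_ext :: "(real \<Rightarrow> real \<Rightarrow> real) \<Rightarrow> real \<Rightarrow> real \<Rightarrow> real" where
  "copula_ext C u v = C (clip u) (clip v)"

text \<open>The mass intended for \<open>rect a b c d\<close>, by inclusion-exclusion at its four
  corners.\<close>

definition copula_volume :: "(real \<Rightarrow> real \<Rightarrow> real) \<Rightarrow> real \<Rightarrow> real \<Rightarrow> real \<Rightarrow> real \<Rightarrow> real" where
  "copula_volume C a b c d = copula_ext C b d - copula_ext C b c - copula_ext C a d + copula_ext C a c"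

lemma clip_in [simp]: "0 \<le> clip x" "clip x \<le> 1"
  by (auto simp: clip_def)

lemma clip_id [simp]: "0 \<le> x \<Longrightarrow> x \<le> 1 \<Longrightarrow> clip x = x"
  by (auto simp: clip_def)

lemma clip_mono: "x \<le> y \<Longrightarrow> clip x \<le> clip y"
  by (auto simp: clip_def)

lemma clip_lipschitz: "\<bar>clip x - clip y\<bar> \<le> \<bar>x - y\<bar>"
  by (auto simp: clip_def)

lemma copula_bounds: "copula C \<Longrightarrow> u \<in> {0..1} \<Longrightarrow> v \<in> {0..1} \<Longrightarrow> C u v \<in> {0..1}"
  and copula_0_left: "copula C \<Longrightarrow> v \<in> {0..1} \<Longrightarrow> C 0 v = 0"
  and copula_0_right: "copula C \<Longrightarrow> u \<in> {0..1} \<Longrightarrow> C u 0 = 0"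
  and copula_1_right: "copula C \<Longrightarrow> u \<in> {0..1} \<Longrightarrow> C u 1 = u"
  and copula_1_left: "copula C \<Longrightarrow> v \<in> {0..1} \<Longrightarrow> C 1 v = v"
  by (auto simp: copula_def)

lemma copula_2_increasing:
  assumes "copula C" "u1 \<in> {0..1}" "u2 \<in> {0..1}" "v1 \<in> {0..1}" "v2 \<in> {0..1}" "u1 \<le> u2" "v1 \<le> v2"
  shows "0 \<le> C u2 v2 - C u2 v1 - C u1 v2 + C u1 v1"
  using assms by (auto simp: copula_def)

lemma copula_volume_nonneg:
  assumes "copula C" "a \<le> b" "c \<le> d"
  shows "0 \<le> copula_volume C a b c d"
  unfolding copula_volume_def copula_ext_def
  by (rule copula_2_increasing) (use assms clip_mono in auto)

text \<open>For \<open>u \<le> u'\<close>, the strip over \<open>[u, u']\<close> below height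
  \<open>v\<close> has nonnegative volume, which gives monotonicity. The strip above
  \<open>v\<close> has too, and since the margin at height 1 is the identity, this bounds the
  increment by \<open>u' - u\<close>.\<close>

lemma copula_lipschitz_left:
  assumes "copula C" "u \<in> {0..1}" "u' \<in> {0..1}" "v \<in> {0..1}"
  shows "\<bar>C u v - C u' v\<bar> \<le> \<bar>u - u'\<bar>"
proof (cases "u \<le> u'")
  case True
  then show ?thesis
    using copula_2_increasing[OF assms(1), of u u' v 1] copula_2_increasing[OF assms(1), of u u' 0 v] assms
    by (simp add: copula_1_right copula_0_right)
next
  case False
  then show ?thesis
    using copula_2_increasing[OF assms(1), of u' u v 1] copula_2_increasing[OF assms(1), of u' u 0 v] assms
    by (simp add: copula_1_right copula_0_right)
qed

lemma copula_lipschitz_right: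
  assumes "copula C" "u \<in> {0..1}" "v \<in> {0..1}" "v' \<in> {0..1}"
  shows "\<bar>C u v - C u v'\<bar> \<le> \<bar>v - v'\<bar>"
proof (cases "v \<le> v'")
  case True
  then show ?thesis
    using copula_2_increasing[OF assms(1), of u 1 v v'] copula_2_increasing[OF assms(1), of 0 u v v'] assms
    by (simp add: copula_1_left copula_0_left)
next
  case False
  then show ?thesis
    using copula_2_increasing[OF assms(1), of u 1 v' v] copula_2_increasing[OF assms(1), of 0 u v' v] assms
    by (simp add: copula_1_left copula_0_left)
qed

lemma copula_lipschitz:
  assumes "copula C" "u \<in> {0..1}" "u' \<in> {0..1}" "v \<in> {0..1}" "v' \<in> {0..1}"
  shows "\<bar>C u v - C u' v'\<bar> \<le> \<bar>u - u'\<bar> + \<bar>v - v'\<bar>"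
  using copula_lipschitz_left[OF assms(1,2,3,4)] copula_lipschitz_right[OF assms(1,3,4,5)]
  by linarith

lemma copula_ext_lipschitz:
  assumes "copula C"
  shows "\<bar>copula_ext C u v - copula_ext C u' v'\<bar> \<le> \<bar>u - u'\<bar> + \<bar>v - v'\<bar>"
  using copula_lipschitz[OF assms, of "clip u" "clip u'" "clip v" "clip v'"]
    clip_lipschitz[of u u'] clip_lipschitz[of v v']
  by (simp add: copula_ext_def)

lemma continuous_on_copula_ext [continuous_intros]:
  assumes C: "copula C" and f: "continuous_on S f" and g: "continuous_on S g"
  shows "continuous_on S (\<lambda>x. copula_ext C (f x) (g x))"
  unfolding continuous_on_def
proof
  fix x assume x: "x \<in> S"
  have "((\<lambda>y. \<bar>f y - f x\<bar> + \<bar>g y - g x\<bar>) \<longlongrightarrow> 0) (at x within S)"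
    using f g x unfolding continuous_on_def by (auto intro!: tendsto_eq_intros)
  then have "((\<lambda>y. copula_ext C (f y) (g y) - copula_ext C (f x) (g x)) \<longlongrightarrow> 0) (at x within S)"
    by (rule Lim_null_comparison[rotated]) (simp add: copula_ext_lipschitz[OF C])
  then show "((\<lambda>x. copula_ext C (f x) (g x)) \<longlongrightarrow> copula_ext C (f x) (g x)) (at x within S)"
    using LIM_zero_iff by blast
qed

section \<open>Existence and uniqueness of the copula measure\<close>

definition rect :: "real \<Rightarrow> real \<Rightarrow> real \<Rightarrow> real \<Rightarrow> (real \<times> real) set" where
  "rect a b c d = {a<..b} \<times> {c<..d}"

definition rects :: "(real \<times> real) set set" where
  "rects = {rect a b c d | a b c d. a \<le> b \<and> c \<le> d}"

text \<open>The mass of each grid cell sits in its upper right corner, so that the content of the quadrant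
  below \<open>(u, v)\<close> counts exactly the cells contained in it.\<close>

definition grid_content :: "(real \<Rightarrow> real \<Rightarrow> real) \<Rightarrow> nat \<Rightarrow> (real \<times> real) set \<Rightarrow> real" where
  "grid_content C N A = (\<Sum>i<N. \<Sum>j<N.
     copula_volume C (real i / real N) (real (Suc i) / real N) (real j / real N) (real (Suc j) / real N) *
     indicator A (real (Suc i) / real N, real (Suc j) / real N))"

lemma grid_content_mono:
  assumes "copula C" "A \<subseteq> B"
  shows "grid_content C N A \<le> grid_content C N B"
  unfolding grid_content_def using assms
  by (intro sum_mono mult_left_mono copula_volume_nonneg) (auto simp: indicator_def divide_simps)

lemma grid_content_sum:
  assumes "finite I" "disjoint_family_on A I"
  shows "grid_content C N (\<Union>i\<in>I. A i) = (\<Sum>i\<in>I. grid_content C N (A i))"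
  unfolding grid_content_def
  by (subst sum.swap, rule sum.cong[OF refl], subst sum.swap, rule sum.cong[OF refl])
     (simp add: indicator_UN_disjoint[OF assms] sum_distrib_left)

text \<open>Overlaps are allowed here; this serves the enlarged rectangles in the compactness
  argument of \<open>copula_volume_sums\<close>.\<close>

lemma grid_content_subadditive:
  assumes "copula C" "finite I"
  shows "grid_content C N (\<Union>i\<in>I. A i) \<le> (\<Sum>i\<in>I. grid_content C N (A i))"
  using \<open>finite I\<close>
proof induction
  case empty
  then show ?case by (simp add: grid_content_def)
next
  case (insert k I)
  have "grid_content C N (A k \<union> B) \<le> grid_content C N (A k) + grid_content C N B" for B
    unfolding grid_content_def sum.distrib[symmetric] distrib_left[symmetric]
    by (intro sum_mono mult_left_mono copula_volume_nonneg assms(1))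
       (auto simp: indicator_def divide_simps)
  from this[of "\<Union>i\<in>I. A i"] insert show ?case by simp
qed

text \<open>The cells counted by the quadrant form a double telescoping sum. The terms on the axes
  vanish, which leaves \<open>C\<close> at the clipped corner rounded down to the grid.\<close>

lemma grid_content_quadrant:
  assumes C: "copula C" and N: "N > 0"
  shows "grid_content C N ({..u} \<times> {..v}) =
    C (real (nat \<lfloor>N * clip u\<rfloor>) / N) (real (nat \<lfloor>N * clip v\<rfloor>) / N)"
proof -
  define G where "G i j = C (real i / N) (real j / N)" for i j
  \<comment> \<open>The number of cells along one axis whose far edge is at most
    \<open>u\<close>.\<close>
  define k where "k u = nat \<lfloor>N * clip u\<rfloor>" for u
  have k: "i < N \<and> real (Suc i) / N \<le> u \<longleftrightarrow> i < k u" for i u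
  proof -
    have "i < k u \<longleftrightarrow> real (Suc i) \<le> N * clip u"
      unfolding k_def by (simp add: le_nat_floor Suc_le_eq[symmetric] le_nat_iff le_floor_iff)
    also have "\<dots> \<longleftrightarrow> real (Suc i) / N \<le> clip u"
      using N by (simp add: field_simps)
    also have "\<dots> \<longleftrightarrow> real (Suc i) / N \<le> 1 \<and> real (Suc i) / N \<le> u"
    proof -
      \<comment> \<open>The far edge of a cell is positive, so clipping at 0 does not affect the
        comparison; clipping at 1 accounts for the condition \<open>i < N\<close>.\<close>
      have "0 < real (Suc i) / N" using N by simp
      then show ?thesis unfolding clip_def by linarith
    qed
    also have "real (Suc i) / N \<le> 1 \<longleftrightarrow> i < N"
      using N by (auto simp: divide_simps)
    finally show ?thesis by simp
  qed
  have kN: "k u \<le> N" for u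
    using k[of _ u] by (metis leI less_irrefl)
  \<comment> \<open>Grouped as an increment in \<open>j\<close> of increments in \<open>i\<close>,
    so that the inner sum telescopes first.\<close>
  have G: "copula_volume C (real i / N) (real (Suc i) / N) (real j / N) (real (Suc j) / N)
      = (G (Suc i) (Suc j) - G i (Suc j)) - (G (Suc i) j - G i j)" if "i < N" "j < N" for i j
    unfolding copula_volume_def copula_ext_def G_def using that N
    by (subst (1 2 3 4 5 6 7 8) clip_id) (auto simp: divide_simps)
  have "grid_content C N ({..u} \<times> {..v}) =
      (\<Sum>i<N. \<Sum>j<N. if j < k v then if i < k u then
        (G (Suc i) (Suc j) - G i (Suc j)) - (G (Suc i) j - G i j) else 0 else 0)"
    unfolding grid_content_def
    by (intro sum.cong refl) (auto simp: G indicator_def k[symmetric] simp del: of_nat_Suc)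
  also have "\<dots> = (\<Sum>i<k u. \<Sum>j<k v. (G (Suc i) (Suc j) - G i (Suc j)) - (G (Suc i) j - G i j))"
  proof -
    have *: "(\<Sum>i<N. if i < k w then f i else 0) = (\<Sum>i<k w. f i)" for w and f :: "nat \<Rightarrow> real"
      using kN[of w] by (intro sum.mono_neutral_cong_right) auto
    have "(\<Sum>i<N. \<Sum>j<N. if j < k v then if i < k u then f i j else 0 else 0) =
        (\<Sum>i<N. if i < k u then \<Sum>j<N. if j < k v then f i j else 0 else 0)" for f :: "nat \<Rightarrow> nat \<Rightarrow> real"
      by (intro sum.cong refl) (auto intro!: sum.cong sum.neutral)
    then show ?thesis by (simp only: *)
  qed
  also have "\<dots> = (\<Sum>i<k u. (G (Suc i) (k v) - G (Suc i) 0) - (G i (k v) - G i 0))"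
    by (intro sum.cong refl, subst sum_lessThan_telescope[of "\<lambda>j. G (Suc _) j - G _ j"]) simp
  also have "\<dots> = (G (k u) (k v) - G (k u) 0) - (G 0 (k v) - G 0 0)"
    by (rule sum_lessThan_telescope)
  also have "\<dots> = G (k u) (k v)"
    using C kN by (simp add: G_def copula_0_left copula_0_right divide_simps)
  finally show ?thesis by (simp add: G_def k_def)
qed

text \<open>Rounding down to the grid moves each clipped coordinate by at most \<open>1 / N\<close>,
  so the Lipschitz bound limits the error to \<open>2 / N\<close>.\<close>

lemma grid_content_quadrant_tendsto:
  assumes C: "copula C"
  shows "(\<lambda>N. grid_content C N ({..u} \<times> {..v})) \<longlonglongrightarrow> copula_ext C u v"
proof -
  have "norm (grid_content C N ({..u} \<times> {..v}) - copula_ext C u v) \<le> 2 / N" if N: "N > 0" for N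
  proof -
    let ?k = "\<lambda>x. real (nat \<lfloor>N * clip x\<rfloor>) / N"
    have k: "?k x \<in> {0..1}" "\<bar>?k x - clip x\<bar> \<le> 1 / N" for x
    proof -
      have *: "real (nat \<lfloor>N * clip x\<rfloor>) \<le> N * clip x" "N * clip x - 1 \<le> real (nat \<lfloor>N * clip x\<rfloor>)"
        by (simp; linarith)+
      have "N * clip x \<le> N" by (simp add: mult_left_le)
      with *(1) have "real (nat \<lfloor>N * clip x\<rfloor>) \<le> N" by linarith
      then show "?k x \<in> {0..1}" using N by (auto simp: divide_simps)
      have "\<bar>real (nat \<lfloor>N * clip x\<rfloor>) - N * clip x\<bar> \<le> 1" using * by linarith
      also have "real (nat \<lfloor>N * clip x\<rfloor>) - N * clip x = N * (?k x - clip x)"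
        using N by (simp add: field_simps)
      finally show "\<bar>?k x - clip x\<bar> \<le> 1 / N" using N by (simp add: abs_mult field_simps)
    qed
    have "\<bar>C (?k u) (?k v) - C (clip u) (clip v)\<bar> \<le> \<bar>?k u - clip u\<bar> + \<bar>?k v - clip v\<bar>"
      by (rule copula_lipschitz[OF C]) (use k in auto)
    also have "\<dots> \<le> 1 / N + 1 / N" using k by (intro add_mono)
    finally show ?thesis
      unfolding grid_content_quadrant[OF C N] copula_ext_def by simp
  qed
  then have "\<forall>\<^sub>F N in sequentially. norm (grid_content C N ({..u} \<times> {..v}) - copula_ext C u v) \<le> 2 / N"
    by (rule eventually_mono[OF eventually_gt_at_top[of 0]])
  moreover have "(\<lambda>N. 2 / real N) \<longlonglongrightarrow> 0" by real_asymp
  ultimately have "(\<lambda>N. grid_content C N ({..u} \<times> {..v}) - copula_ext C u v) \<longlonglongrightarrow> 0"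
    by (rule Lim_null_comparison)
  then show ?thesis using LIM_zero_iff by blast
qed

text \<open>The indicator of a rectangle is the signed sum of four quadrant indicators, with the
  same signs as in \<open>copula_volume\<close>, and the grid content is linear in the
  indicator.\<close>

lemma grid_content_rect_tendsto:
  assumes C: "copula C" and "a \<le> b" "c \<le> d"
  shows "(\<lambda>N. grid_content C N (rect a b c d)) \<longlonglongrightarrow> copula_volume C a b c d"
proof -
  let ?q = "\<lambda>u v. {..u} \<times> {..v} :: (real \<times> real) set"
  have "indicator (rect a b c d) x = (indicator (?q b d) x - indicator (?q b c) x -
      indicator (?q a d) x + indicator (?q a c) x :: real)" for x
    using assms(2,3) by (cases x) (auto simp: rect_def indicator_def)
  then have "grid_content C N (rect a b c d) = grid_content C N (?q b d) - grid_content C N (?q b c) -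
      grid_content C N (?q a d) + grid_content C N (?q a c)" for N
    unfolding grid_content_def sum_subtractf[symmetric] sum.distrib[symmetric]
    by (intro sum.cong refl) (simp only: ring_distribs)
  then show ?thesis
    unfolding copula_volume_def by (auto intro!: tendsto_intros grid_content_quadrant_tendsto[OF C])
qed

lemma semiring_of_rects: "semiring_of_sets UNIV rects"
proof
  show "rects \<subseteq> Pow UNIV" by simp
  have "{} = rect 0 0 0 0" by (simp add: rect_def)
  then show "{} \<in> rects" unfolding rects_def by blast
next
  fix A B assume "A \<in> rects" "B \<in> rects"
  then obtain a b c d a' b' c' d' where A: "A = rect a b c d" "a \<le> b" "c \<le> d"
    and B: "B = rect a' b' c' d'" "a' \<le> b'" "c' \<le> d'"
    by (auto simp: rects_def)
  \<comment> \<open>The endpoints of the intersection are clamped into the sides of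
    \<open>A\<close>, so they stay ordered even when the intersection is empty.\<close>
  define x where "x = max a (min b a')"
  define y where "y = max x (min b b')"
  define z where "z = max c (min d c')"
  define w where "w = max z (min d d')"
  have xy: "a \<le> x" "x \<le> y" "y \<le> b" "c \<le> z" "z \<le> w" "w \<le> d"
    using A B by (auto simp: x_def y_def z_def w_def)
  have 1: "{a<..b} \<inter> {a'<..b'} = {x<..y}" "{c<..d} \<inter> {c'<..d'} = {z<..w}"
    using A B by (auto simp: x_def y_def z_def w_def)
  have "A \<inter> B = rect x y z w" using 1 unfolding A B rect_def by blast
  then show "A \<inter> B \<in> rects" unfolding rects_def using xy by blast
  \<comment> \<open>The difference is cut into the full-height strips left and right of the
    intersection and the two pieces below and above it.\<close>
  let ?C = "{rect a x c d, rect y b c d, rect x y c z, rect x y w d}"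
  have "?C \<subseteq> rects" unfolding rects_def using xy A by fastforce
  moreover have "disjoint ?C"
    using xy by (auto simp: disjoint_def rect_def)
  moreover have "A - B = \<Union>?C"
  proof -
    have "A - B = A - rect x y z w" using \<open>A \<inter> B = rect x y z w\<close> by blast
    also have "\<dots> = \<Union>?C" using xy by (auto simp: A rect_def)
    finally show ?thesis .
  qed
  ultimately show "\<exists>C\<subseteq>rects. finite C \<and> disjoint C \<and> A - B = \<Union>C"
    by (intro exI[of _ ?C]) simp
qed

section \<open>Countable additivity of the rectangle volume\<close>

lemma copula_volume_lipschitz:
  assumes "copula C"
  shows "\<bar>copula_volume C a b c d - copula_volume C a' b' c' d'\<bar> \<le>
    2 * (\<bar>a - a'\<bar> + \<bar>b - b'\<bar> + \<bar>c - c'\<bar> + \<bar>d - d'\<bar>)"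
proof -
  let ?D = "\<lambda>u v u' v'. copula_ext C u v - copula_ext C u' v'"
  have "\<bar>copula_volume C a b c d - copula_volume C a' b' c' d'\<bar> \<le>
      \<bar>?D b d b' d'\<bar> + \<bar>?D b c b' c'\<bar> + \<bar>?D a d a' d'\<bar> + \<bar>?D a c a' c'\<bar>"
    unfolding copula_volume_def by linarith
  \<comment> \<open>Each edge of the rectangle enters two corners, hence the factor 2.\<close>
  also have "\<dots> \<le> (\<bar>b - b'\<bar> + \<bar>d - d'\<bar>) + (\<bar>b - b'\<bar> + \<bar>c - c'\<bar>) + (\<bar>a - a'\<bar> + \<bar>d - d'\<bar>) + (\<bar>a - a'\<bar> + \<bar>c - c'\<bar>)"
    by (intro add_mono copula_ext_lipschitz assms)
  finally show ?thesis by simp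
qed

text \<open>Finite inequalities between grid contents pass to volumes in the limit. Disjointness
  bounds the partial sums from above. For the converse, a slightly shrunk compact rectangle is
  covered by finitely many slightly enlarged open ones, and the Lipschitz estimate controls the
  error.\<close>

lemma copula_volume_sums:
  assumes C: "copula C"
    and le: "\<And>i. a i \<le> b i" "\<And>i. c i \<le> d i" "p \<le> q" "r \<le> s"
    and disj: "disjoint_family (\<lambda>i. rect (a i) (b i) (c i) (d i))"
    and union: "(\<Union>i::nat. rect (a i) (b i) (c i) (d i)) = rect p q r s"
  shows "(\<lambda>i. copula_volume C (a i) (b i) (c i) (d i)) sums copula_volume C p q r s"
proof -
  let ?V = "\<lambda>i. copula_volume C (a i) (b i) (c i) (d i)"
  have upper: "(\<Sum>i<n. ?V i) \<le> copula_volume C p q r s" for n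
  proof (rule LIMSEQ_le)
    show "(\<lambda>N. \<Sum>i<n. grid_content C N (rect (a i) (b i) (c i) (d i))) \<longlonglongrightarrow> (\<Sum>i<n. ?V i)"
      by (intro tendsto_sum grid_content_rect_tendsto C le)
    show "(\<lambda>N. grid_content C N (rect p q r s)) \<longlonglongrightarrow> copula_volume C p q r s"
      by (intro grid_content_rect_tendsto C le)
    have "(\<Sum>i<n. grid_content C N (rect (a i) (b i) (c i) (d i))) \<le> grid_content C N (rect p q r s)" for N
      by (subst grid_content_sum[symmetric])
         (use disj union in \<open>auto simp: disjoint_family_on_def intro!: grid_content_mono C\<close>)
    then show "\<exists>N. \<forall>n'\<ge>N. (\<Sum>i<n. grid_content C n' (rect (a i) (b i) (c i) (d i)))
        \<le> grid_content C n' (rect p q r s)" by blast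
  qed
  have lower: "\<exists>n. copula_volume C p q r s - e \<le> (\<Sum>i<n. ?V i)" if e: "e > 0" for e
  proof (cases "p < q \<and> r < s")
    case False
    \<comment> \<open>With a side of length zero the corner values cancel in pairs, and the empty
      partial sum suffices.\<close>
    then have "copula_volume C p q r s = 0" using le by (auto simp: copula_volume_def)
    then show ?thesis using e by (intro exI[of _ 0]) simp
  next
    case True
    \<comment> \<open>Moving the two lower edges by \<open>\<delta>\<close> costs at most
      \<open>4 * \<delta>\<close> in volume, that is half of \<open>e\<close>; the bound by the side
      lengths keeps the shrunk edges ordered.\<close>
    define \<delta> where "\<delta> = min (e / 8) (min (q - p) (s - r))"
    have \<delta>: "\<delta> > 0" "\<delta> \<le> e / 8" "p + \<delta> \<le> q" "r + \<delta> \<le> s" using True e unfolding \<delta>_def by linarith+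
    \<comment> \<open>Enlarging the \<open>i\<close>-th rectangle costs at most
      \<open>4 * \<eta> i\<close>; these costs form a geometric series with total
      \<open>e / 2\<close>, the other half of \<open>e\<close>.\<close>
    define \<eta> where "\<eta> i = e / 16 * (1 / 2) ^ i" for i :: nat
    have \<eta>: "\<eta> i > 0" for i using e by (simp add: \<eta>_def)
    \<comment> \<open>A half-open rectangle is already open at its lower edges, so only the upper
      edges are pushed outwards.\<close>
    let ?U = "\<lambda>i. {a i<..<b i + \<eta> i} \<times> {c i<..<d i + \<eta> i}"
    have "compact ({p + \<delta>..q} \<times> {r + \<delta>..s})" by (intro compact_Times compact_Icc)
    moreover have "open (?U i)" for i by (intro open_Times open_greaterThanLessThan)
    moreover have "{p + \<delta>..q} \<times> {r + \<delta>..s} \<subseteq> (\<Union>i\<in>UNIV. ?U i)"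
    proof -
      have "{p + \<delta>..q} \<times> {r + \<delta>..s} \<subseteq> rect p q r s" using \<delta> by (auto simp: rect_def)
      also have "\<dots> \<subseteq> (\<Union>i\<in>UNIV. ?U i)"
        unfolding union[symmetric] using le_less_trans[OF _ less_add_same_cancel1[THEN iffD2, OF \<eta>]]
        by (intro UN_mono) (auto simp: rect_def)
      finally show ?thesis .
    qed
    ultimately obtain I where I: "finite I" "{p + \<delta>..q} \<times> {r + \<delta>..s} \<subseteq> (\<Union>i\<in>I. ?U i)"
      by (rule compactE_image) blast
    obtain n where n: "I \<subseteq> {..<n}" using \<open>finite I\<close> finite_nat_iff_bounded by blast
    let ?V' = "\<lambda>i. copula_volume C (a i) (b i + \<eta> i) (c i) (d i + \<eta> i)"
    let ?R' = "\<lambda>i. rect (a i) (b i + \<eta> i) (c i) (d i + \<eta> i)"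
    have "rect (p + \<delta>) q (r + \<delta>) s \<subseteq> {p + \<delta>..q} \<times> {r + \<delta>..s}" by (auto simp: rect_def)
    also have "\<dots> \<subseteq> (\<Union>i\<in>I. ?U i)" by fact
    also have "\<dots> \<subseteq> (\<Union>i<n. ?R' i)" using n by (intro UN_mono) (auto simp: rect_def)
    finally have sub: "rect (p + \<delta>) q (r + \<delta>) s \<subseteq> (\<Union>i<n. ?R' i)" .
    have le': "a i \<le> b i + \<eta> i" "c i \<le> d i + \<eta> i" for i using le(1,2)[of i] \<eta>[of i] by auto
    have "copula_volume C (p + \<delta>) q (r + \<delta>) s \<le> (\<Sum>i<n. ?V' i)"
    proof (rule LIMSEQ_le)
      show "(\<lambda>N. grid_content C N (rect (p + \<delta>) q (r + \<delta>) s)) \<longlonglongrightarrow> copula_volume C (p + \<delta>) q (r + \<delta>) s"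
        by (intro grid_content_rect_tendsto C \<delta>)
      show "(\<lambda>N. \<Sum>i<n. grid_content C N (?R' i)) \<longlonglongrightarrow> (\<Sum>i<n. ?V' i)"
        by (intro tendsto_sum grid_content_rect_tendsto C le')
      have "grid_content C N (rect (p + \<delta>) q (r + \<delta>) s) \<le> (\<Sum>i<n. grid_content C N (?R' i))" for N
        using grid_content_mono[OF C sub] grid_content_subadditive[OF C, of "{..<n}"]
        by (rule order_trans) simp
      then show "\<exists>N. \<forall>n'\<ge>N. grid_content C n' (rect (p + \<delta>) q (r + \<delta>) s) \<le>
          (\<Sum>i<n. grid_content C n' (?R' i))" by blast
    qed
    also have "\<dots> \<le> (\<Sum>i<n. ?V i + 4 * \<eta> i)"
    proof (rule sum_mono)
      fix i
      show "?V' i \<le> ?V i + 4 * \<eta> i"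
        using copula_volume_lipschitz[OF C, of "a i" "b i + \<eta> i" "c i" "d i + \<eta> i" "a i" "b i" "c i" "d i"]
          \<eta>[of i] by simp
    qed
    also have "\<dots> = (\<Sum>i<n. ?V i) + e / 4 * (\<Sum>i<n. (1 / 2) ^ i)"
      by (simp add: sum.distrib sum_distrib_left \<eta>_def)
    also have "(\<Sum>i<n. (1 / 2) ^ i) \<le> (2 :: real)"
      by (simp add: sum_gp_strict)
    also have "copula_volume C p q r s - e / 2 \<le> copula_volume C (p + \<delta>) q (r + \<delta>) s"
      using copula_volume_lipschitz[OF C, of p q r s "p + \<delta>" q "r + \<delta>" s] \<delta> by simp
    finally have "copula_volume C p q r s - e / 2 \<le> (\<Sum>i<n. ?V i) + e / 4 * 2"
      using e by simp
    then show ?thesis by (intro exI[of _ n]) simp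
  qed
  show ?thesis
    unfolding sums_def
  proof (rule LIMSEQ_I)
    fix e :: real assume e: "e > 0"
    then obtain n where n: "copula_volume C p q r s - e / 2 \<le> (\<Sum>i<n. ?V i)"
      using lower[of "e / 2"] by auto
    have "norm ((\<Sum>i<m. ?V i) - copula_volume C p q r s) < e" if "m \<ge> n" for m
    proof -
      have "(\<Sum>i<n. ?V i) \<le> (\<Sum>i<m. ?V i)"
        using that by (intro sum_mono2) (auto intro: copula_volume_nonneg C le)
      then show ?thesis using n e upper[of m] by simp
    qed
    then show "\<exists>n. \<forall>m\<ge>n. norm ((\<Sum>i<m. ?V i) - copula_volume C p q r s) < e" by blast
  qed
qed

lemma sigma_sets_rects: "sigma_sets UNIV rects = sets borel"
proof (rule antisym)
  show "sigma_sets UNIV rects \<subseteq> sets borel"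
    by (rule sets.sigma_sets_subset'[where M=borel, simplified])
       (auto simp: rects_def rect_def borel_Times)
  have "{..x} \<in> sigma_sets UNIV rects" for x :: "real \<times> real"
  proof -
    \<comment> \<open>A closed quadrant is exhausted by half-open rectangles with the same upper
      corner whose lower corners recede to minus infinity.\<close>
    have "{..x} = (\<Union>n::nat. rect (fst x - n) (fst x) (snd x - n) (snd x))"
    proof (intro antisym subsetI)
      fix y assume y: "y \<in> {..x}"
      obtain n :: nat where "max (fst x - fst y) (snd x - snd y) < n" using reals_Archimedean2 by blast
      then have "y \<in> rect (fst x - n) (fst x) (snd x - n) (snd x)"
        using y by (auto simp: rect_def less_eq_prod_def mem_Times_iff)
      then show "y \<in> (\<Union>n::nat. rect (fst x - n) (fst x) (snd x - n) (snd x))" by blast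
    qed (auto simp: rect_def less_eq_prod_def)
    moreover have "rect (fst x - n) (fst x) (snd x - n) (snd x) \<in> rects" for n :: nat
      unfolding rects_def by fastforce
    ultimately show ?thesis by (simp only:) (rule sigma_sets.Union, rule sigma_sets.Basic)
  qed
  then show "sets borel \<subseteq> sigma_sets UNIV rects"
    by (subst borel_eq_atMost) (auto intro!: sigma_sets_mono)
qed

lemma copula_plane_measure_exists:
  assumes C: "copula C"
  obtains P :: "(real \<times> real) measure" where "sets P = sets borel"
    "\<And>a b c d. a \<le> b \<Longrightarrow> c \<le> d \<Longrightarrow> emeasure P (rect a b c d) = copula_volume C a b c d"
proof -
  \<comment> \<open>The limit of grid contents depends on the set alone. Defining \<open>f\<close>
    through it avoids a choice of endpoints, which an empty rectangle does not determine.\<close>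
  define f where "f A = ennreal (lim (\<lambda>N. grid_content C N A))" for A
  have f: "f (rect a b c d) = copula_volume C a b c d" if "a \<le> b" "c \<le> d" for a b c d
    using limI[OF grid_content_rect_tendsto[OF C that]] by (simp add: f_def)
  have pos: "positive rects f"
    using f[of 0 0 0 0] by (simp add: positive_def rect_def copula_volume_def)
  have ca: "countably_additive rects f"
  proof (rule countably_additiveI)
    fix A :: "nat \<Rightarrow> _" assume A: "range A \<subseteq> rects" "disjoint_family A" "\<Union> (range A) \<in> rects"
    obtain p q r s where u: "\<Union> (range A) = rect p q r s" "p \<le> q" "r \<le> s"
      using A(3) by (auto simp: rects_def)
    have "\<forall>i. A i \<in> rects" using A(1) by blast
    then have "\<forall>i. \<exists>a b c d. A i = rect a b c d \<and> a \<le> b \<and> c \<le> d"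
      by (simp add: rects_def)
    then obtain a b c d where abcd: "\<And>i. A i = rect (a i) (b i) (c i) (d i)" "\<And>i. a i \<le> b i" "\<And>i. c i \<le> d i"
      by metis
    have "(\<lambda>i. copula_volume C (a i) (b i) (c i) (d i)) sums copula_volume C p q r s"
      using A(2) u(1) by (intro copula_volume_sums C abcd u(2,3)) (simp_all add: abcd(1)[abs_def])
    then have "(\<Sum>i. ennreal (copula_volume C (a i) (b i) (c i) (d i))) = ennreal (copula_volume C p q r s)"
      by (intro suminf_ennreal_eq copula_volume_nonneg C abcd)
    then show "(\<Sum>i. f (A i)) = f (\<Union> (range A))"
      unfolding u f[OF u(2,3)] by (simp add: abcd f)
  qed
  obtain \<mu> where \<mu>: "\<forall>A\<in>rects. \<mu> A = f A" "measure_space UNIV (sigma_sets UNIV rects) \<mu>"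
    using semiring_of_sets.caratheodory[OF semiring_of_rects pos ca] by blast
  define P where "P = measure_of UNIV rects \<mu>"
  have "sets P = sets borel" by (simp add: P_def sigma_sets_rects)
  moreover have "emeasure P (rect a b c d) = copula_volume C a b c d" if "a \<le> b" "c \<le> d" for a b c d
  proof -
    have "rect a b c d \<in> rects" using that by (auto simp: rects_def)
    then have "emeasure P (rect a b c d) = \<mu> (rect a b c d)"
      using \<mu>(2)
      by (intro emeasure_measure_of[OF P_def]) (auto simp: P_def measure_space_def)
    then show ?thesis using \<mu>(1) \<open>rect a b c d \<in> rects\<close> f[OF that] by simp
  qed
  ultimately show ?thesis by (rule that)
qed

section \<open>Representing measures on the unit square\<close>

abbreviation square_algebra :: "(real \<times> real) measure" where
  "square_algebra \<equiv> restrict_space borel unit_square"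

text \<open>The property inside the definite description of \<open>copula_measure\<close>, named so
  that existence and uniqueness can be proved separately.\<close>

definition represents :: "(real \<times> real) measure \<Rightarrow> (real \<Rightarrow> real \<Rightarrow> real) \<Rightarrow> bool" where
  "represents M C \<longleftrightarrow> prob_space M \<and> sets M = sets square_algebra \<and>
     (\<forall>u\<in>{0..1}. \<forall>v\<in>{0..1}. measure M ({0..u} \<times> {0..v}) = C u v)"

lemma unit_square_borel [simp]: "unit_square \<in> sets borel"
  by (intro borel_Times) auto

lemma copula_represented:
  assumes C: "copula C"
  shows "\<exists>M. represents M C"
proof -
  obtain P where P: "sets P = sets borel"
    "\<And>a b c d. a \<le> b \<Longrightarrow> c \<le> d \<Longrightarrow> emeasure P (rect a b c d) = copula_volume C a b c d"
    using copula_plane_measure_exists[OF C] by blast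
  have cdf: "emeasure P ({0..u} \<times> {0..v}) = C u v" if uv: "u \<in> {0..1}" "v \<in> {0..1}" for u v
  proof (rule antisym)
    \<comment> \<open>The closed rectangle lies between the half-open ones with lower corners at 0
      and at -1. Both have volume \<open>C u v\<close>, because \<open>copula_ext C\<close> vanishes
      when a coordinate is at most 0.\<close>
    have "clip (-1) = 0" by (simp add: clip_def)
    then have vol: "copula_volume C (-1) u (-1) v = C u v" "copula_volume C 0 u 0 v = C u v"
      using uv by (auto simp: copula_volume_def copula_ext_def copula_0_left[OF C] copula_0_right[OF C])
    have "emeasure P ({0..u} \<times> {0..v}) \<le> emeasure P (rect (-1) u (-1) v)"
      by (intro emeasure_mono) (auto simp: rect_def P(1) borel_Times)
    then show "emeasure P ({0..u} \<times> {0..v}) \<le> C u v" using P(2)[of "-1" u "-1" v] uv vol by simp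
    have "emeasure P (rect 0 u 0 v) \<le> emeasure P ({0..u} \<times> {0..v})"
      by (intro emeasure_mono) (auto simp: rect_def P(1) borel_Times)
    then show "C u v \<le> emeasure P ({0..u} \<times> {0..v})" using P(2)[of 0 u 0 v] uv vol by simp
  qed
  let ?M = "restrict_space P unit_square"
  have "emeasure ?M (space ?M) = 1"
    using cdf[of 1 1] sets_eq_imp_space_eq[OF P(1)] copula_1_left[OF C, of 1]
    by (simp add: space_restrict_space emeasure_restrict_space P(1))
  then have "prob_space ?M" by (rule prob_spaceI)
  moreover have "measure ?M ({0..u} \<times> {0..v}) = C u v" if uv: "u \<in> {0..1}" "v \<in> {0..1}" for u v
  proof -
    have "emeasure ?M ({0..u} \<times> {0..v}) = C u v"
      using uv by (subst emeasure_restrict_space) (auto simp: P(1) cdf)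
    then show ?thesis using copula_bounds[OF C uv] by (simp add: measure_def)
  qed
  moreover have "sets ?M = sets square_algebra" using P(1) by (rule sets_restrict_space_cong)
  ultimately show ?thesis unfolding represents_def by blast
qed

text \<open>Both measures are pushed forward to the plane, where the closed quadrants are an
  intersection-stable generator. A quadrant meets the unit square in nothing or in a rectangle
  anchored at the origin, whose mass is prescribed.\<close>

lemma represents_unique:
  assumes M: "represents M C" and N: "represents N C"
  shows "M = N"
proof -
  have meas: "id \<in> measurable L borel" "{..(x, y)} \<inter> space L = (if x < 0 \<or> y < 0 then {} else {0..min 1 x} \<times> {0..min 1 y})"
    "emeasure (distr L borel id) {..(x, y)} = (if x < 0 \<or> y < 0 then 0 else C (min 1 x) (min 1 y))"
    if L: "represents L C" for L x y
  proof -
    have "sets L = sets square_algebra" and "prob_space L" using L by (auto simp: represents_def)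
    interpret prob_space L by fact
    show id: "id \<in> measurable L borel"
      by (subst measurable_cong_sets[OF \<open>sets L = _\<close> refl])
         (rule measurable_restrict_space1[OF measurable_ident])
    show eq: "{..(x, y)} \<inter> space L = (if x < 0 \<or> y < 0 then {} else {0..min 1 x} \<times> {0..min 1 y})"
    proof -
      have "space L = unit_square"
        using sets_eq_imp_space_eq[OF \<open>sets L = _\<close>] by (simp add: space_restrict_space)
      moreover have "{..(x, y)} = {..x} \<times> {..y}" by auto
      moreover have "{..z} \<inter> {0..1} = (if z < 0 then {} else {0..min 1 z})" for z :: real
        by auto
      ultimately show ?thesis by (simp add: Times_Int_Times)
    qed
    show "emeasure (distr L borel id) {..(x, y)} = (if x < 0 \<or> y < 0 then 0 else C (min 1 x) (min 1 y))"
      using L id by (auto simp: emeasure_distr eq emeasure_eq_measure represents_def)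
  qed
  have distr: "distr M borel id = distr N borel id"
  proof (rule measure_eqI_generator_eq[where E="range atMost" and \<Omega>=UNIV and A="\<lambda>n. {..(real n, real n)}"])
    have "{..x} \<inter> {..y} = {..inf x y}" for x y :: "real \<times> real" by auto
    then show "Int_stable (range (atMost :: real \<times> real \<Rightarrow> _))"
      by (auto simp: Int_stable_def)
    show "emeasure (distr M borel id) X = emeasure (distr N borel id) X" if "X \<in> range atMost" for X
      using that meas(3)[OF M] meas(3)[OF N] by auto
    show "(\<Union>n. {..(real n, real n)}) = UNIV"
    proof (intro antisym subsetI UNIV_I)
      fix y :: "real \<times> real"
      obtain n :: nat where "max (fst y) (snd y) < n" using reals_Archimedean2 by blast
      then show "y \<in> (\<Union>n. {..(real n, real n)})" by (auto simp: less_eq_prod_def intro!: exI[of _ n])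
    qed
    show "emeasure (distr M borel id) {..(real i, real i)} \<noteq> \<infinity>" for i
      using meas(3)[OF M] by simp
  qed (auto simp: borel_eq_atMost)
  show ?thesis
  proof (rule measure_eqI)
    show "sets M = sets N" using M N by (simp add: represents_def)
    fix A assume A: "A \<in> sets M"
    then have "A \<in> sets borel" "A \<subseteq> unit_square"
      using M by (auto simp: represents_def sets_restrict_space_iff)
    \<comment> \<open>The pushforward along the identity keeps the mass of Borel subsets of the
      square, so equality on the plane comes back.\<close>
    moreover have "emeasure (distr L borel id) A = emeasure L A" if "represents L C" for L
      using that calculation sets_eq_imp_space_eq[of L square_algebra]
      by (auto simp: emeasure_distr meas(1) represents_def space_restrict_space Int_absorb2)
    ultimately show "emeasure M A = emeasure N A" using distr M N by metis
  qed
qed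

lemma copula_measure_eqI: "represents M C \<Longrightarrow> copula_measure C = M"
  unfolding copula_measure_def represents_def[symmetric]
  by (rule the_equality) (auto intro: represents_unique)

lemma represents_copula_measure: "copula C \<Longrightarrow> represents (copula_measure C) C"
  using copula_represented copula_measure_eqI by metis

section \<open>The measure of an ordinal sum\<close>

lemma clip_min: "clip (min x y) = min (clip x) (clip y)"
  by (auto simp: clip_def)

text \<open>Off the open unit square some clipped coordinate is 0 or 1, and there the boundary
  conditions force every copula to agree with the minimum.\<close>

lemma copula_ext_boundary:
  assumes C: "copula C" and xy: "\<not> (0 < x \<and> x < 1 \<and> 0 < y \<and> y < 1)"
  shows "copula_ext C x y = clip (min x y)"
proof -
  consider "clip x = 0" | "clip y = 0" | "clip x = 1" | "clip y = 1"
    using xy by (force simp: clip_def)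
  then show ?thesis
    by cases (simp_all add: copula_ext_def clip_min copula_0_left[OF C] copula_0_right[OF C]
        copula_1_left[OF C] copula_1_right[OF C])
qed

abbreviation unit_lborel :: "real measure" where
  "unit_lborel \<equiv> restrict_space lborel {0..1}"

lemma prob_space_unit_lborel: "prob_space unit_lborel"
  by (rule prob_spaceI) (simp add: space_restrict_space emeasure_restrict_space)

lemma diagonal_measurable: "(\<lambda>t. (t, t)) \<in> unit_lborel \<rightarrow>\<^sub>M square_algebra"
proof (rule measurable_restrict_space2)
  have "(\<lambda>t. (t, t)) \<in> borel \<rightarrow>\<^sub>M (borel :: (real \<times> real) measure)" by measurable
  then show "(\<lambda>t. (t, t)) \<in> unit_lborel \<rightarrow>\<^sub>M (borel :: (real \<times> real) measure)"
    by (intro measurable_restrict_space1) simp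
qed (simp add: space_restrict_space)

locale ordinal_sum_family =
  fixes K :: "nat set" and a b :: "nat \<Rightarrow> real" and C :: "nat \<Rightarrow> real \<Rightarrow> real \<Rightarrow> real"
  assumes finite_K: "finite K"
    and cop: "k \<in> K \<Longrightarrow> copula (C k)"
    and ab: "k \<in> K \<Longrightarrow> 0 \<le> a k" "k \<in> K \<Longrightarrow> a k < b k" "k \<in> K \<Longrightarrow> b k \<le> 1"
    and disj: "disjoint_family_on (\<lambda>k. {a k<..<b k}) K"
begin

section \<open>The ordinal sum as the minimum plus block corrections\<close>

definition to_unit :: "nat \<Rightarrow> real \<Rightarrow> real" where
  "to_unit k u = (u - a k) / (b k - a k)"

definition from_unit :: "nat \<Rightarrow> real \<times> real \<Rightarrow> real \<times> real" where
  "from_unit k p = (a k + (b k - a k) * fst p, a k + (b k - a k) * snd p)"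

lemma to_unit_min: "k \<in> K \<Longrightarrow> to_unit k (min u v) = min (to_unit k u) (to_unit k v)"
  using ab(2)[of k] by (auto simp: to_unit_def min_def divide_simps)

lemma to_unit_in:
  assumes "k \<in> K"
  shows "to_unit k u \<in> {0..1} \<longleftrightarrow> u \<in> {a k..b k}" "0 < to_unit k u \<and> to_unit k u < 1 \<longleftrightarrow> u \<in> {a k<..<b k}"
  using ab(2)[OF assms] by (auto simp: to_unit_def divide_simps)

text \<open>The mass that block \<open>k\<close> contributes to \<open>[0,u] \<times> [0,v]\<close>, minus the mass that the uniform
  distribution on the diagonal has there.\<close>

definition correction :: "nat \<Rightarrow> real \<Rightarrow> real \<Rightarrow> real" where
  "correction k u v = (b k - a k) *
     (copula_ext (C k) (to_unit k u) (to_unit k v) - clip (to_unit k (min u v)))"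

text \<open>Off the open square of the block, \<open>copula_ext_boundary\<close> makes the two terms
  of the correction equal.\<close>

lemma correction_eq_0:
  assumes k: "k \<in> K" and uv: "\<not> (u \<in> {a k<..<b k} \<and> v \<in> {a k<..<b k})"
  shows "correction k u v = 0"
proof -
  have "\<not> (0 < to_unit k u \<and> to_unit k u < 1 \<and> 0 < to_unit k v \<and> to_unit k v < 1)"
    using uv to_unit_in(2)[OF k, of u] to_unit_in(2)[OF k, of v] by blast
  from copula_ext_boundary[OF cop[OF k] this] show ?thesis
    unfolding correction_def to_unit_min[OF k] by simp
qed

text \<open>Since blocks have positive length, a point in one closed block and another open block
  forces the two open blocks to overlap. The mixed form matches the closed squares of
  \<open>ordinal_sum\<close> with the open squares outside which corrections vanish.\<close>

lemma block_unique:
  assumes "k \<in> K" "l \<in> K" "u \<in> {a k..b k}" "u \<in> {a l<..<b l}"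
  shows "l = k"
proof (rule ccontr)
  assume "l \<noteq> k"
  have "max (a k) (a l) < min (b k) (b l)" using assms ab(2) by auto
  then obtain x where "max (a k) (a l) < x" "x < min (b k) (b l)" using dense by blast
  then have "x \<in> {a k<..<b k} \<inter> {a l<..<b l}" by auto
  with disj assms \<open>l \<noteq> k\<close> show False by (auto simp: disjoint_family_on_def)
qed

lemma ordinal_sum_block:
  assumes "k \<in> K" "u \<in> {a k..b k}" "v \<in> {a k..b k}"
  shows "ordinal_sum K a b C u v = a k + (b k - a k) * C k (to_unit k u) (to_unit k v)"
  unfolding to_unit_def
  by (rule ordinal_sum_eq) (use assms cop ab disj in auto)

text \<open>At most one correction is nonzero at a given point. Replacing the case distinction by a
  sum makes continuity evident and gives the shape in which the mixture integral appears.\<close>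

lemma ordinal_sum_eq_correction:
  "ordinal_sum K a b C u v = min u v + (\<Sum>k\<in>K. correction k u v)"
proof (cases "\<exists>k\<in>K. (u, v) \<in> {a k..b k} \<times> {a k..b k}")
  case True
  then obtain k where k: "k \<in> K" "u \<in> {a k..b k}" "v \<in> {a k..b k}" by auto
  have "correction l u v = 0" if "l \<in> K - {k}" for l
    using block_unique[OF k(1) _ k(2)] that by (intro correction_eq_0) auto
  then have "(\<Sum>k\<in>K. correction k u v) = correction k u v"
    using finite_K k(1) by (simp add: sum.remove)
  also have "\<dots> = (b k - a k) * (C k (to_unit k u) (to_unit k v) - to_unit k (min u v))"
  proof -
    have "clip (to_unit k w) = to_unit k w" if "w \<in> {a k..b k}" for w
      using to_unit_in(1)[OF k(1), of w] that by simp
    moreover have "min u v \<in> {a k..b k}" using k by auto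
    ultimately show ?thesis using k by (simp add: correction_def copula_ext_def)
  qed
  \<comment> \<open>Rescaling turns the subtracted term into \<open>min u v - a k\<close>, so the
    minimum cancels and \<open>a k\<close> remains.\<close>
  also have "\<dots> = (b k - a k) * C k (to_unit k u) (to_unit k v) - (min u v - a k)"
    using ab(2)[OF k(1)] by (subst right_diff_distrib) (simp add: to_unit_def)
  finally show ?thesis unfolding ordinal_sum_block[OF k] by simp
next
  case False
  then have "correction k u v = 0" if "k \<in> K" for k
    using that by (intro correction_eq_0) (auto simp: less_imp_le)
  then show ?thesis unfolding ordinal_sum_def if_not_P[OF False] by simp
qed

section \<open>The mixture measure\<close>

definition block :: "real \<Rightarrow> nat option" where
  "block t = (if \<exists>k\<in>K. t \<in> {a k<..<b k} then Some (SOME k. k \<in> K \<and> t \<in> {a k<..<b k}) else None)"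

lemma block_eq_None: "block t = None \<longleftrightarrow> (\<forall>k\<in>K. t \<notin> {a k<..<b k})"
  by (auto simp: block_def)

lemma block_eq_Some: "block t = Some k \<longleftrightarrow> k \<in> K \<and> t \<in> {a k<..<b k}"
proof -
  have eq: "l = k" if "l \<in> K \<and> t \<in> {a l<..<b l}" "k \<in> K \<and> t \<in> {a k<..<b k}" for l k
    using that block_unique[of k l t] by auto
  have "(SOME l. l \<in> K \<and> t \<in> {a l<..<b l}) = k" if "k \<in> K \<and> t \<in> {a k<..<b k}" for k
    using that by (intro some_equality) (auto intro: eq)
  then show ?thesis
    unfolding block_def by (smt (verit) option.inject option.distinct(1))
qed

text \<open>The conditional law of the point given \<open>t\<close>. Inside a block it depends on
  \<open>t\<close> only through the index; block endpoints lying in no open block count as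
  uncovered.\<close>

definition kernel :: "real \<Rightarrow> (real \<times> real) measure" where
  "kernel t = (case block t of None \<Rightarrow> return square_algebra (t, t)
     | Some k \<Rightarrow> distr (copula_measure (C k)) square_algebra (from_unit k))"

definition ordinal_measure :: "(real \<times> real) measure" where
  "ordinal_measure = unit_lborel \<bind> kernel"

lemma copula_measure_facts:
  assumes "k \<in> K"
  shows "prob_space (copula_measure (C k))" "sets (copula_measure (C k)) = sets square_algebra"
    "space (copula_measure (C k)) = unit_square"
    "u \<in> {0..1} \<Longrightarrow> v \<in> {0..1} \<Longrightarrow> measure (copula_measure (C k)) ({0..u} \<times> {0..v}) = C k u v"
  using represents_copula_measure[OF cop[OF assms]] sets_eq_imp_space_eq[of "copula_measure (C k)" square_algebra]
  by (auto simp: represents_def space_restrict_space)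

lemma from_unit_in:
  assumes k: "k \<in> K" and p: "p \<in> unit_square"
  shows "from_unit k p \<in> {a k..b k} \<times> {a k..b k}" "from_unit k p \<in> unit_square"
proof -
  have *: "a k + (b k - a k) * x \<in> {a k..b k}" if "x \<in> {0..1}" for x
  proof -
    have "(b k - a k) * x \<le> b k - a k" "0 \<le> (b k - a k) * x"
      using ab(2)[OF k] that by (auto intro: mult_left_le)
    then show ?thesis unfolding atLeastAtMost_iff by linarith
  qed
  then show "from_unit k p \<in> {a k..b k} \<times> {a k..b k}"
    using p by (auto simp: from_unit_def)
  then show "from_unit k p \<in> unit_square" using ab[OF k] by (auto simp: mem_Times_iff)
qed

lemma from_unit_measurable:
  assumes k: "k \<in> K"
  shows "from_unit k \<in> copula_measure (C k) \<rightarrow>\<^sub>M square_algebra"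
  unfolding measurable_cong_sets[OF copula_measure_facts(2)[OF k] refl]
proof (rule measurable_restrict_space2)
  have "continuous_on UNIV (from_unit k)"
    unfolding from_unit_def by (intro continuous_intros)
  then show "from_unit k \<in> square_algebra \<rightarrow>\<^sub>M borel"
    by (intro measurable_restrict_space1 borel_measurable_continuous_onI)
  show "from_unit k \<in> space square_algebra \<rightarrow> unit_square"
    using from_unit_in(2)[OF k] by (auto simp: space_restrict_space)
qed

lemma prob_space_kernel:
  assumes "t \<in> {0..1}"
  shows "prob_space (kernel t)"
  unfolding kernel_def using assms
  by (auto split: option.split simp: block_eq_Some space_restrict_space
      intro!: prob_space_return prob_space.prob_space_distr copula_measure_facts from_unit_measurable)

text \<open>The index \<open>block t\<close> takes finitely many values, each on a Borel set. With
  the index fixed, the kernel is either constant or the diagonal embedding followed by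
  \<open>return\<close>.\<close>

lemma kernel_measurable: "kernel \<in> unit_lborel \<rightarrow>\<^sub>M subprob_algebra square_algebra"
proof -
  let ?I = "insert None (Some ` K)"
  let ?f = "\<lambda>i t. case i of None \<Rightarrow> return square_algebra (t, t)
     | Some k \<Rightarrow> distr (copula_measure (C k)) square_algebra (from_unit k)"
  have "(\<lambda>t. ?f (block t) t) \<in> unit_lborel \<rightarrow>\<^sub>M subprob_algebra square_algebra"
  proof (rule measurable_compose_countable'[where I="?I"])
    show "countable ?I" using finite_K by (simp add: countable_finite)
    fix i assume "i \<in> ?I"
    then show "?f i \<in> unit_lborel \<rightarrow>\<^sub>M subprob_algebra square_algebra"
    proof
      assume "i = None"
      then show ?thesis
        using measurable_compose[OF diagonal_measurable return_measurable] by simp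
    next
      assume "i \<in> Some ` K"
      then obtain k where k: "i = Some k" "k \<in> K" by blast
      then have "prob_space (distr (copula_measure (C k)) square_algebra (from_unit k))"
        by (intro prob_space.prob_space_distr copula_measure_facts from_unit_measurable)
      then show ?thesis
        by (simp add: k space_subprob_algebra prob_space_imp_subprob_space)
    qed
  next
    have restrict: "A \<inter> {0..1} \<in> sets unit_lborel" if "A \<in> sets borel" for A
      using that by (auto simp: sets_restrict_space)
    have "block -` {i} \<inter> {0..1} \<in> sets unit_lborel" if "i \<in> ?I" for i
    proof (cases i)
      case None
      then have "block -` {i} = UNIV - (\<Union>k\<in>K. {a k<..<b k})" by (auto simp: block_eq_None)
      also have "\<dots> \<in> sets borel" using finite_K by (intro sets.Diff sets.finite_UN) auto
      finally show ?thesis by (rule restrict)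
    next
      case (Some k)
      then have "block -` {i} = {a k<..<b k}" using that by (auto simp: block_eq_Some)
      then show ?thesis by (simp add: restrict)
    qed
    moreover have "block t \<in> ?I" for t by (cases "block t") (auto simp: block_eq_Some)
    ultimately show "block \<in> unit_lborel \<rightarrow>\<^sub>M count_space ?I"
      using finite_K by (subst measurable_count_space_eq2) (auto simp: space_restrict_space)
  qed
  then show ?thesis unfolding kernel_def .
qed

lemma sets_kernel: "sets (kernel t) = sets square_algebra"
  by (simp add: kernel_def split: option.split)

lemma sets_ordinal_measure: "sets ordinal_measure = sets square_algebra"
  unfolding ordinal_measure_def
  by (rule sets_bind) (auto simp: sets_kernel space_restrict_space)

lemma prob_space_ordinal_measure: "prob_space ordinal_measure"
  unfolding ordinal_measure_def
  by (rule prob_space.prob_space_bind[OF prob_space_unit_lborel _ kernel_measurable])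
     (auto simp: space_restrict_space prob_space_kernel intro!: AE_I2)

section \<open>Integrals modified on blocks and the distribution function of the mixture\<close>

lemma integral_block:
  fixes h :: "real \<Rightarrow> real"
  assumes k: "k \<in> K"
  shows "(\<integral>t. indicator {a k<..<b k} t * h t \<partial>unit_lborel) = (\<integral>t. indicator {a k<..<b k} t * h t \<partial>lborel)"
proof -
  have "(\<integral>t. indicator {a k<..<b k} t * h t \<partial>unit_lborel) =
      (\<integral>t. indicator {0..1} t *\<^sub>R (indicator {a k<..<b k} t * h t) \<partial>lborel)"
    by (rule integral_restrict_space) simp
  also have "\<dots> = (\<integral>t. indicator {a k<..<b k} t * h t \<partial>lborel)"
    using ab[OF k] by (intro Bochner_Integration.integral_cong refl) (auto simp: indicator_def)
  finally show ?thesis .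
qed

text \<open>Each block exchanges its share of the integral of \<open>h\<close> for its length times
  \<open>c k\<close>. This is used with an indicator for the distribution function and with the
  identity for Kendall's tau.\<close>

lemma integral_blocks:
  assumes h: "integrable unit_lborel h"
  shows "(\<integral>t. (case block t of None \<Rightarrow> h t | Some k \<Rightarrow> c k) \<partial>unit_lborel) =
    (\<integral>t. h t \<partial>unit_lborel) +
    (\<Sum>k\<in>K. (b k - a k) * c k - (\<integral>t. indicator {a k<..<b k} t * h t \<partial>unit_lborel))"
proof -
  have eq: "(case block t of None \<Rightarrow> h t | Some k \<Rightarrow> c k) =
      h t + (\<Sum>k\<in>K. indicator {a k<..<b k} t * c k - indicator {a k<..<b k} t * h t)" for t
  proof (cases "block t")
    case None
    then show ?thesis using block_eq_None[of t] by simp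
  next
    case (Some k)
    then have "(\<Sum>l\<in>K. indicator {a l<..<b l} t * c l - indicator {a l<..<b l} t * h t) =
      (\<Sum>l\<in>K. if l = k then c k - h t else 0)"
    proof (intro sum.cong refl)
      fix l assume l: "l \<in> K"
      have "t \<in> {a l<..<b l} \<longleftrightarrow> l = k"
        using block_unique[of k l t] Some l by (auto simp: block_eq_Some)
      then show "indicator {a l<..<b l} t * c l - indicator {a l<..<b l} t * h t = (if l = k then c k - h t else 0)"
        by (auto simp: indicator_def)
    qed
    then show ?thesis using Some finite_K block_eq_Some[of t k] by simp
  qed
  have meas: "{a k<..<b k} \<inter> {0..1} \<in> sets unit_lborel" for k
    by (auto simp: sets_restrict_space)
  have ind: "integrable unit_lborel (\<lambda>t. indicator {a k<..<b k} t * g t)"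
    if "integrable unit_lborel g" for k and g :: "real \<Rightarrow> real"
    using integrable_real_mult_indicator[OF meas that, of k]
    by (rule Bochner_Integration.integrable_cong[THEN iffD1, rotated -1])
       (auto simp: space_restrict_space indicator_def)
  have const: "(\<integral>t. indicator {a k<..<b k} t * c k \<partial>unit_lborel) = (b k - a k) * c k" if "k \<in> K" for k
    using ab(2)[OF that] by (subst integral_block[OF that]) simp
  interpret prob_space unit_lborel by (rule prob_space_unit_lborel)
  have int: "integrable unit_lborel (\<lambda>t. indicator {a k<..<b k} t * c k - indicator {a k<..<b k} t * h t)" for k
    by (intro Bochner_Integration.integrable_diff ind h integrable_const)
  have diff: "(\<integral>t. indicator {a k<..<b k} t * c k - indicator {a k<..<b k} t * h t \<partial>unit_lborel) =
      (b k - a k) * c k - (\<integral>t. indicator {a k<..<b k} t * h t \<partial>unit_lborel)" if "k \<in> K" for k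
    unfolding const[OF that, symmetric]
    by (intro Bochner_Integration.integral_diff ind h integrable_const)
  have "(\<integral>t. (case block t of None \<Rightarrow> h t | Some k \<Rightarrow> c k) \<partial>unit_lborel) = (\<integral>t. h t \<partial>unit_lborel) +
      (\<integral>t. (\<Sum>k\<in>K. indicator {a k<..<b k} t * c k - indicator {a k<..<b k} t * h t) \<partial>unit_lborel)"
    unfolding eq by (intro Bochner_Integration.integral_add Bochner_Integration.integrable_sum h int)
  then show ?thesis
    by (simp only: Bochner_Integration.integral_sum[OF int] diff cong: sum.cong)
qed


lemma measure_kernel:
  assumes t: "t \<in> {0..1}" and uv: "u \<in> {0..1}" "v \<in> {0..1}"
  shows "measure (kernel t) ({0..u} \<times> {0..v}) =
    (case block t of None \<Rightarrow> indicator {..min u v} t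
      | Some k \<Rightarrow> copula_ext (C k) (to_unit k u) (to_unit k v))"
proof -
  have A: "{0..u} \<times> {0..v} \<in> sets square_algebra"
    using uv by (auto simp: sets_restrict_space_iff borel_Times)
  show ?thesis
  proof (cases "block t")
    case None
    have "measure (return square_algebra (t, t)) ({0..u} \<times> {0..v}) = indicator ({0..u} \<times> {0..v}) (t, t)"
      by (simp add: measure_return[OF A])
    then show ?thesis using t None by (auto simp: kernel_def indicator_def)
  next
    case (Some k)
    then have k: "k \<in> K" by (simp add: block_eq_Some)
    \<comment> \<open>Rescaling an anchored rectangle gives an anchored rectangle clipped to the
      unit square, except that it is empty when a side ends before the block starts.\<close>
    have pre: "from_unit k -` ({0..u} \<times> {0..v}) \<inter> unit_square =
      (if u < a k \<or> v < a k then {} else {0..clip (to_unit k u)} \<times> {0..clip (to_unit k v)})" (is "?L = ?R")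
    proof (rule set_eqI)
      fix p :: "real \<times> real"
      have *: "a k + (b k - a k) * x \<le> w \<longleftrightarrow> x \<le> to_unit k w" for x w
        using ab(2)[OF k] by (simp add: to_unit_def field_simps)
      have **: "w < a k \<longleftrightarrow> to_unit k w < 0" for w
        using ab(2)[OF k] by (simp add: to_unit_def field_simps)
      have "p \<in> ?L \<longleftrightarrow> p \<in> unit_square \<and> fst p \<le> to_unit k u \<and> snd p \<le> to_unit k v"
        using from_unit_in(2)[OF k, of p] by (auto simp: from_unit_def * mem_Times_iff)
      also have "\<dots> \<longleftrightarrow> p \<in> ?R"
        unfolding ** by (auto simp: mem_Times_iff clip_def)
      finally show "p \<in> ?L \<longleftrightarrow> p \<in> ?R" .
    qed
    \<comment> \<open>In the empty case the formula also gives 0, since the clipped argument is 0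
      and the copula vanishes on the axes.\<close>
    have 0: "clip (to_unit k w) = 0" if "w < a k" for w
      using that ab(2)[OF k] by (simp add: to_unit_def clip_def divide_simps)
    have "measure (kernel t) ({0..u} \<times> {0..v}) = measure (copula_measure (C k)) ?L"
      using Some by (simp add: kernel_def measure_distr[OF from_unit_measurable[OF k] A] copula_measure_facts(3)[OF k])
    also have "\<dots> = copula_ext (C k) (to_unit k u) (to_unit k v)"
      unfolding pre using copula_measure_facts(4)[OF k]
      by (auto simp: copula_ext_def 0 copula_0_left[OF cop[OF k]] copula_0_right[OF cop[OF k]])
    finally show ?thesis using Some by simp
  qed
qed

text \<open>The uniform diagonal part contributes \<open>min u v\<close>. Each block then trades the
  length of its part below \<open>min u v\<close> for its scaled copula value, and this exchange is
  exactly \<open>correction\<close>.\<close>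

lemma represents_ordinal_measure: "represents ordinal_measure (ordinal_sum K a b C)"
  unfolding represents_def
proof (intro conjI ballI)
  fix u v :: real assume uv: "u \<in> {0..1}" "v \<in> {0..1}"
  let ?m = "min u v"
  have A: "{0..u} \<times> {0..v} \<in> sets square_algebra"
    using uv by (auto simp: sets_restrict_space_iff borel_Times)
  interpret U: prob_space unit_lborel by (rule prob_space_unit_lborel)
  have int: "integrable unit_lborel (indicator {..?m} :: real \<Rightarrow> real)"
    by (intro U.integrable_const_bound[where B=1] measurable_restrict_space1) auto
  have len: "(\<integral>t. indicator {a k<..<b k} t * indicator {..?m} t \<partial>unit_lborel) =
      (b k - a k) * clip (to_unit k ?m)" if k: "k \<in> K" for k
  proof -
    have "(\<integral>t. indicator {a k<..<b k} t * indicator {..?m} t \<partial>unit_lborel) =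
        (\<integral>t. indicat_real ({a k<..<b k} \<inter> {..?m}) t \<partial>lborel)"
      unfolding integral_block[OF k] by (simp only: indicator_inter_arith)
    also have "\<dots> = measure lborel ({a k<..<b k} \<inter> {..?m})" by simp
    also have "\<dots> = (b k - a k) * clip (to_unit k ?m)"
    proof -
      \<comment> \<open>The cases in which \<open>clip\<close> yields 0, its argument, or 1.\<close>
      consider "?m \<le> a k" | "a k < ?m" "?m < b k" | "b k \<le> ?m" by linarith
      then show ?thesis
      proof cases
        case 1
        then have "{a k<..<b k} \<inter> {..?m} = {}" by auto
        moreover have "clip (to_unit k ?m) = 0"
          using 1 ab(2)[OF k] by (simp add: to_unit_def clip_def divide_simps)
        ultimately show ?thesis by simp
      next
        case 2
        then have "{a k<..<b k} \<inter> {..?m} = {a k<..?m}" by auto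
        moreover have "clip (to_unit k ?m) = to_unit k ?m"
          using 2 to_unit_in(2)[OF k, of ?m] by simp
        ultimately show ?thesis using 2 ab(2)[OF k] by (simp add: to_unit_def)
      next
        case 3
        then have "{a k<..<b k} \<inter> {..?m} = {a k<..<b k}" by auto
        moreover have "clip (to_unit k ?m) = 1"
          using 3 ab(2)[OF k] by (simp add: to_unit_def clip_def divide_simps)
        ultimately show ?thesis using ab(2)[OF k] by simp
      qed
    qed
    finally show ?thesis .
  qed
  have m: "(\<integral>t. indicator {..?m} t \<partial>unit_lborel) = ?m"
  proof -
    have "(\<integral>t. indicator {..?m} t \<partial>unit_lborel) = (\<integral>t. indicator {0..1} t *\<^sub>R indicat_real {..?m} t \<partial>lborel)"
      by (rule integral_restrict_space) simp
    also have "\<dots> = (\<integral>t. indicat_real {0..?m} t \<partial>lborel)"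
      using uv by (intro Bochner_Integration.integral_cong refl) (auto simp: indicator_def)
    finally show ?thesis using uv by simp
  qed
  have "measure ordinal_measure ({0..u} \<times> {0..v}) = (\<integral>t. measure (kernel t) ({0..u} \<times> {0..v}) \<partial>unit_lborel)"
    unfolding ordinal_measure_def by (rule U.measure_bind[OF kernel_measurable A])
  also have "\<dots> = (\<integral>t. (case block t of None \<Rightarrow> indicator {..?m} t
      | Some k \<Rightarrow> copula_ext (C k) (to_unit k u) (to_unit k v)) \<partial>unit_lborel)"
    by (intro Bochner_Integration.integral_cong refl measure_kernel uv) (simp add: space_restrict_space)
  also have "\<dots> = ?m + (\<Sum>k\<in>K. correction k u v)"
    unfolding integral_blocks[OF int] m
    by (intro arg_cong2[of _ _ _ _ "(+)"] sum.cong refl) (simp add: len correction_def right_diff_distrib)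
  finally show "measure ordinal_measure ({0..u} \<times> {0..v}) = ordinal_sum K a b C u v"
    by (simp add: ordinal_sum_eq_correction)
qed (rule prob_space_ordinal_measure sets_ordinal_measure)+

section \<open>Integration of the ordinal sum against the mixture\<close>

lemma continuous_on_ordinal_sum: "continuous_on UNIV (\<lambda>p. ordinal_sum K a b C (fst p) (snd p))"
  unfolding ordinal_sum_eq_correction correction_def to_unit_def clip_def
  by (intro continuous_intros cop) (use ab in force)+

lemma integral_copula:
  assumes k: "k \<in> K"
  shows "integrable (copula_measure (C k)) (\<lambda>p. C k (fst p) (snd p))"
    "(\<integral>p. C k (fst p) (snd p) \<partial>copula_measure (C k)) = (kendall_tau (C k) + 1) / 4"
proof -
  interpret prob_space "copula_measure (C k)" by (rule copula_measure_facts[OF k])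
  \<comment> \<open>Measurability is shown for \<open>copula_ext\<close>, which is continuous and
    agrees with \<open>C k\<close> on the unit square, the space of the measure.\<close>
  have "(\<lambda>p. copula_ext (C k) (fst p) (snd p)) \<in> borel_measurable (copula_measure (C k))"
    unfolding measurable_cong_sets[OF copula_measure_facts(2)[OF k] refl]
    by (intro measurable_restrict_space1 borel_measurable_continuous_onI continuous_intros cop k)
  then have "(\<lambda>p. C k (fst p) (snd p)) \<in> borel_measurable (copula_measure (C k))"
    by (rule measurable_cong[THEN iffD1, rotated])
       (auto simp: copula_ext_def copula_measure_facts(3)[OF k])
  then show "integrable (copula_measure (C k)) (\<lambda>p. C k (fst p) (snd p))"
    using copula_bounds[OF cop[OF k]]
    by (intro integrable_const_bound[where B=1] AE_I2) (auto simp: copula_measure_facts(3)[OF k])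
  show "(\<integral>p. C k (fst p) (snd p) \<partial>copula_measure (C k)) = (kendall_tau (C k) + 1) / 4"
    by (simp add: kendall_tau_def case_prod_unfold)
qed

lemma integral_kernel:
  assumes t: "t \<in> {0..1}"
  shows "(\<integral>p. ordinal_sum K a b C (fst p) (snd p) \<partial>kernel t) =
    (case block t of None \<Rightarrow> t | Some k \<Rightarrow> a k + (b k - a k) * ((kendall_tau (C k) + 1) / 4))"
proof -
  let ?B = "\<lambda>p. ordinal_sum K a b C (fst p) (snd p)"
  have meas: "?B \<in> borel_measurable square_algebra"
    by (intro measurable_restrict_space1 borel_measurable_continuous_onI continuous_on_ordinal_sum)
  show ?thesis
  proof (cases "block t")
    case None
    have "(\<integral>p. ?B p \<partial>kernel t) = ?B (t, t)"
      using None t meas by (simp add: kernel_def integral_return space_restrict_space)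
    \<comment> \<open>At a diagonal point outside all blocks every correction vanishes.\<close>
    also have "\<dots> = t"
      using None unfolding ordinal_sum_eq_correction block_eq_None
      by (simp add: correction_eq_0)
    finally show ?thesis using None by simp
  next
    case (Some k)
    then have k: "k \<in> K" by (simp add: block_eq_Some)
    interpret prob_space "copula_measure (C k)" by (rule copula_measure_facts[OF k])
    have "(\<integral>p. ?B p \<partial>kernel t) = (\<integral>p. ?B (from_unit k p) \<partial>copula_measure (C k))"
      using Some by (simp add: kernel_def integral_distr[OF from_unit_measurable[OF k] meas])
    also have "\<dots> = (\<integral>p. a k + (b k - a k) * C k (fst p) (snd p) \<partial>copula_measure (C k))"
    proof (rule Bochner_Integration.integral_cong[OF refl])
      fix p assume "p \<in> space (copula_measure (C k))"
      then have p: "p \<in> unit_square" by (simp only: copula_measure_facts(3)[OF k])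
      have "to_unit k (fst (from_unit k p)) = fst p" "to_unit k (snd (from_unit k p)) = snd p"
        using ab(2)[OF k] by (simp_all add: to_unit_def from_unit_def)
      then show "?B (from_unit k p) = a k + (b k - a k) * C k (fst p) (snd p)"
        using from_unit_in(1)[OF k p] by (subst ordinal_sum_block[OF k]) (auto simp: mem_Times_iff)
    qed
    also have "\<dots> = a k + (b k - a k) * ((kendall_tau (C k) + 1) / 4)"
      using integral_copula[OF k] by (simp add: prob_space)
    finally show ?thesis using Some by simp
  qed
qed

lemma kendall_tau_ordinal_sum:
  "kendall_tau (ordinal_sum K a b C) = 1 - (\<Sum>k\<in>K. (b k - a k)\<^sup>2 * (1 - kendall_tau (C k)))"
proof -
  let ?B = "\<lambda>p. ordinal_sum K a b C (fst p) (snd p)"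
  interpret U: prob_space unit_lborel by (rule prob_space_unit_lborel)
  \<comment> \<open>On the unit square the values are probabilities under the mixture; this bound
    justifies the iterated integral below.\<close>
  have bounded: "\<bar>?B p\<bar> \<le> 1" if "p \<in> unit_square" for p
  proof -
    interpret O: prob_space ordinal_measure by (rule prob_space_ordinal_measure)
    have "?B p = measure ordinal_measure ({0..fst p} \<times> {0..snd p})"
      using represents_ordinal_measure that by (auto simp: represents_def mem_Times_iff)
    then show ?thesis by simp
  qed
  have int: "integrable unit_lborel (\<lambda>t. t)"
    by (intro U.integrable_const_bound[where B=1] measurable_restrict_space1 AE_I2)
       (auto simp: space_restrict_space)
  have mean: "(\<integral>t. t * indicator {c..d} t \<partial>lborel) = (d\<^sup>2 - c\<^sup>2) / 2" if "c \<le> d" for c d :: real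
  proof -
    have "((\<lambda>t. t\<^sup>2 / 2) has_real_derivative x) (at x)" for x :: real
      by (auto intro!: derivative_eq_intros)
    from integral_FTC_Icc_real[OF that this] show ?thesis by (simp add: diff_divide_distrib)
  qed
  have half: "(\<integral>t. t \<partial>unit_lborel) = 1 / 2"
    using mean[of 0 1] by (simp add: integral_restrict_space mult.commute)
  have part: "(\<integral>t. indicator {a k<..<b k} t * t \<partial>unit_lborel) = ((b k)\<^sup>2 - (a k)\<^sup>2) / 2" if k: "k \<in> K" for k
  proof -
    have "(\<integral>t. indicator {a k<..<b k} t * t \<partial>unit_lborel) = (\<integral>t. t * indicator {a k<..<b k} t \<partial>lborel)"
      unfolding integral_block[OF k] by (simp only: mult.commute)
    also have "\<dots> = (\<integral>t. t * indicator {a k..b k} t \<partial>lborel)"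
    proof (rule integral_cong_AE)
      \<comment> \<open>The open and the closed block differ only in their endpoints, a null
        set.\<close>
      show "AE t in lborel. t * indicator {a k<..<b k} t = t * indicator {a k..b k} t"
        using AE_lborel_singleton[of "a k"] AE_lborel_singleton[of "b k"]
        by eventually_elim (auto simp: indicator_def)
    qed simp_all
    finally show ?thesis using mean[of "a k" "b k"] ab(2)[OF k] by simp
  qed
  have "(\<integral>p. ?B p \<partial>copula_measure (ordinal_sum K a b C)) = (\<integral>p. ?B p \<partial>(unit_lborel \<bind> kernel))"
    by (simp add: copula_measure_eqI[OF represents_ordinal_measure] ordinal_measure_def)
  also have "\<dots> = (\<integral>t. \<integral>p. ?B p \<partial>kernel t \<partial>unit_lborel)"
  proof (rule integral_bind[where K=square_algebra and B=1 and B'=1])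
    show "?B \<in> borel_measurable square_algebra"
      by (intro measurable_restrict_space1 borel_measurable_continuous_onI continuous_on_ordinal_sum)
    show "AE t in unit_lborel. emeasure (kernel t) (space (kernel t)) \<le> ennreal 1"
      using prob_space_kernel by (intro AE_I2) (simp add: space_restrict_space prob_space.emeasure_space_1)
    show "finite_measure unit_lborel" by unfold_locales
  qed (simp_all add: bounded space_restrict_space kernel_measurable)
  also have "\<dots> = (\<integral>t. (case block t of None \<Rightarrow> t
      | Some k \<Rightarrow> a k + (b k - a k) * ((kendall_tau (C k) + 1) / 4)) \<partial>unit_lborel)"
    by (intro Bochner_Integration.integral_cong refl integral_kernel) (simp add: space_restrict_space)
  also have "\<dots> = 1 / 2 + (\<Sum>k\<in>K. (b k - a k) * (a k + (b k - a k) * ((kendall_tau (C k) + 1) / 4))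
      - ((b k)\<^sup>2 - (a k)\<^sup>2) / 2)"
    unfolding integral_blocks[OF int] half by (simp add: part)
  \<comment> \<open>Factoring out \<open>b k - a k\<close>, the difference of \<open>a k\<close> and
    the midpoint is minus half the length; adding the length times
    \<open>(kendall_tau (C k) + 1) / 4\<close> leaves minus the length times
    \<open>(1 - kendall_tau (C k)) / 4\<close>.\<close>
  also have "\<dots> = 1 / 2 + (\<Sum>k\<in>K. - (b k - a k)\<^sup>2 * (1 - kendall_tau (C k)) / 4)"
    by (intro arg_cong2[of _ _ _ _ "(+)"] sum.cong refl) (simp add: field_simps power2_eq_square)
  finally show ?thesis
    unfolding kendall_tau_def[of "ordinal_sum K a b C"] case_prod_unfold
    by (simp add: sum_negf sum_divide_distrib[symmetric])
qed

end

theorem proposition3p2: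
  fixes n :: nat
    and a b :: "nat \<Rightarrow> real"
    and C :: "nat \<Rightarrow> real \<Rightarrow> real \<Rightarrow> real"
  assumes "\<And>k. k \<in> {1..n} \<Longrightarrow> copula (C k)"
    and "\<And>k. k \<in> {1..n} \<Longrightarrow> 0 \<le> a k \<and> a k < b k \<and> b k \<le> 1"
    and "disjoint_family_on (\<lambda>k. {a k<..<b k}) {1..n}"
  shows "kendall_tau (ordinal_sum {1..n} a b C) =
    1 - (\<Sum>k = 1..n. (b k - a k)\<^sup>2 * (1 - kendall_tau (C k)))"
proof -
  interpret ordinal_sum_family "{1..n}" a b C
    by unfold_locales (use assms in auto)
  show ?thesis by (rule kendall_tau_ordinal_sum)
qed

end
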